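(* Let $\gamma:I\to\mathcal{HH}_3$ be a non-geodesic non-null curve parametrized by arclength with $B_3=0$ (identically along $\gamma$). Then $k_2^2=1$ and $\gamma$ cannot be biharmonic.
   Context: $\mathcal{HH}_3=(\mathbb{R}^3,g)$ is the 3-dimensional hyperbolic Heisenberg group with the semi-Riemannian metric $g=(dx)^2-(dy)^2-\frac14(dz+2y\,dx-2x\,dy)^2$ and Levi-Civita connection $\nabla$. The frame $e_1=\partial_x-2y\,\partial_z$, $e_2=\partial_y+2x\,\partial_z$, $e_3=2\,\partial_z$ is orthonormal, with $g(e_1,e_1)=1$, $g(e_2,e_2)=g(e_3,e_3)=-1$. For $X=\sum a_ie_i$, $Y=\sum b_ie_i$ put $X\wedge Y=-(a_2b_3-a_3b_2)e_1-(a_1b_3-a_3b_1)e_2+(a_1b_2-a_2b_1)e_3$. Curvature: $R(X,Y)Z=\nabla_X\nabla_YZ-\nabla_Y\nabla_XZ-\nabla_{[X,Y]}Z$. Curves: $I$ is an open interval and $\gamma:I\to\mathcal{HH}_3$ is smooth. Non-null and parametrized by arclength means that $T=\gamma'$ satisfies $g(T,T)=\varepsilon_1$ constant, $\varepsilon_1\in\{1,-1\}$. $\gamma$ is biharmonic if $\nabla_T\nabla_T\nabla_TT-R(T,\nabla_TT)T=0$. Standing assumption: $\nabla_TT$ is nowhere zero ("non-geodesic") and nowhere null, so that the orthonormal Frenet frame $\{T,N,B\}$ is defined: $k_1=|g(\nabla_TT,\nabla_TT)|^{1/2}$, $N$ is the unit vector field with $\nabla_TT=k_1\varepsilon_2N$,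 $B=T\wedge N$, where $\varepsilon_2=g(N,N)$, $\varepsilon_3=g(B,B)$; and the geodesic torsion $k_2$ is defined by the Frenet equations $\nabla_TN=-k_1\varepsilon_1T+k_2\varepsilon_3B$, $\nabla_TB=-k_2\varepsilon_2N$. $B_3$ is the $e_3$-component of $B=\sum B_ie_i$. *)

theory Defs
  imports "HOL-Analysis.Analysis"
begin

text \<open>
  Points of the hyperbolic Heisenberg group and its tangent vectors are both elements of
  \<^typ>\<open>real^3\<close>; the components \<open>$ 1\<close>, \<open>$ 2\<close>, \<open>$ 3\<close> of a tangent vector refer to the coordinate
  frame \<open>\<partial>\<^sub>x\<close>, \<open>\<partial>\<^sub>y\<close>, \<open>\<partial>\<^sub>z\<close>.  A vector field is a function from points to tangent vectors.
\<close>

section \<open>Metric and orthonormal frame\<close>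

definition heis_metric :: "real^3 \<Rightarrow> real^3 \<Rightarrow> real^3 \<Rightarrow> real" where
  "heis_metric p u v =
     u $ 1 * v $ 1 - u $ 2 * v $ 2
     - 1 / 4 * (u $ 3 + 2 * p $ 2 * u $ 1 - 2 * p $ 1 * u $ 2)
             * (v $ 3 + 2 * p $ 2 * v $ 1 - 2 * p $ 1 * v $ 2)"

definition heis_e1 :: "real^3 \<Rightarrow> real^3" where "heis_e1 p = vector [1, 0, - 2 * p $ 2]"
definition heis_e2 :: "real^3 \<Rightarrow> real^3" where "heis_e2 p = vector [0, 1, 2 * p $ 1]"
definition heis_e3 :: "real^3 \<Rightarrow> real^3" where "heis_e3 p = vector [0, 0, 2]"

lemma heis_frame_orthonormal:
  "heis_metric p (heis_e1 p) (heis_e1 p) = 1"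
  "heis_metric p (heis_e2 p) (heis_e2 p) = -1"
  "heis_metric p (heis_e3 p) (heis_e3 p) = -1"
  "heis_metric p (heis_e1 p) (heis_e2 p) = 0"
  "heis_metric p (heis_e1 p) (heis_e3 p) = 0"
  "heis_metric p (heis_e2 p) (heis_e3 p) = 0"
  by (simp_all add: heis_metric_def heis_e1_def heis_e2_def heis_e3_def)

text \<open>Components of a tangent vector at \<open>p\<close> with respect to the orthonormal frame; that these
  are the frame components is the lemma following the definition.\<close>

definition heis_comp :: "real^3 \<Rightarrow> real^3 \<Rightarrow> real^3" where
  "heis_comp p v = vector [v $ 1, v $ 2, (v $ 3 + 2 * p $ 2 * v $ 1 - 2 * p $ 1 * v $ 2) / 2]"

lemma heis_comp_iff:
  "v = a *\<^sub>R heis_e1 p + b *\<^sub>R heis_e2 p + c *\<^sub>R heis_e3 p \<longleftrightarrow> heis_comp p v = vector [a, b, c]"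
  by (auto simp: heis_comp_def heis_e1_def heis_e2_def heis_e3_def vec_eq_iff forall_3
      algebra_simps)

definition heis_wedge :: "real^3 \<Rightarrow> real^3 \<Rightarrow> real^3 \<Rightarrow> real^3" where
  "heis_wedge p X Y =
     (let a = heis_comp p X; b = heis_comp p Y in
        - (a $ 2 * b $ 3 - a $ 3 * b $ 2) *\<^sub>R heis_e1 p
        - (a $ 1 * b $ 3 - a $ 3 * b $ 1) *\<^sub>R heis_e2 p
        + (a $ 1 * b $ 2 - a $ 2 * b $ 1) *\<^sub>R heis_e3 p)"

section \<open>Levi-Civita connection and curvature\<close>

definition heis_metric_matrix :: "real^3 \<Rightarrow> real^3^3" where
  "heis_metric_matrix p = (\<chi> i j. heis_metric p (axis i 1) (axis j 1))"

definition heis_metric_partial :: "3 \<Rightarrow> 3 \<Rightarrow> 3 \<Rightarrow> real^3 \<Rightarrow> real" where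
  "heis_metric_partial i j l p =
     frechet_derivative (\<lambda>q. heis_metric_matrix q $ j $ l) (at p) (axis i 1)"

text \<open>\<open>heis_christoffel k i j\<close> is \<open>\<Gamma>\<^sup>k\<^sub>i\<^sub>j = 1/2 \<Sum>\<^sub>l g\<^sup>k\<^sup>l (\<partial>\<^sub>i g\<^sub>j\<^sub>l + \<partial>\<^sub>j g\<^sub>i\<^sub>l - \<partial>\<^sub>l g\<^sub>i\<^sub>j)\<close>.\<close>

definition heis_christoffel :: "3 \<Rightarrow> 3 \<Rightarrow> 3 \<Rightarrow> real^3 \<Rightarrow> real" where
  "heis_christoffel k i j p =
     1 / 2 * (\<Sum>l\<in>UNIV. matrix_inv (heis_metric_matrix p) $ k $ l *
       (heis_metric_partial i j l p + heis_metric_partial j i l p - heis_metric_partial l i j p))"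

definition heis_gamma :: "real^3 \<Rightarrow> real^3 \<Rightarrow> real^3 \<Rightarrow> real^3" where
  "heis_gamma p u v = (\<chi> k. \<Sum>i\<in>UNIV. \<Sum>j\<in>UNIV. heis_christoffel k i j p * u $ i * v $ j)"

definition heis_nabla :: "(real^3 \<Rightarrow> real^3) \<Rightarrow> (real^3 \<Rightarrow> real^3) \<Rightarrow> real^3 \<Rightarrow> real^3" where
  "heis_nabla X Y p = frechet_derivative Y (at p) (X p) + heis_gamma p (X p) (Y p)"

definition lie_bracket :: "(real^3 \<Rightarrow> real^3) \<Rightarrow> (real^3 \<Rightarrow> real^3) \<Rightarrow> real^3 \<Rightarrow> real^3" where
  "lie_bracket X Y p = frechet_derivative Y (at p) (X p) - frechet_derivative X (at p) (Y p)"

definition heis_curvature_field ::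
  "(real^3 \<Rightarrow> real^3) \<Rightarrow> (real^3 \<Rightarrow> real^3) \<Rightarrow> (real^3 \<Rightarrow> real^3) \<Rightarrow> real^3 \<Rightarrow> real^3" where
  "heis_curvature_field X Y Z p =
     heis_nabla X (heis_nabla Y Z) p - heis_nabla Y (heis_nabla X Z) p
     - heis_nabla (lie_bracket X Y) Z p"

text \<open>The value of the curvature tensor on tangent vectors at \<open>p\<close>.  By tensoriality any smooth
  extension to vector fields gives the same value; we extend by constant coordinates.\<close>

definition heis_curvature :: "real^3 \<Rightarrow> real^3 \<Rightarrow> real^3 \<Rightarrow> real^3 \<Rightarrow> real^3" where
  "heis_curvature p u v w = heis_curvature_field (\<lambda>_. u) (\<lambda>_. v) (\<lambda>_. w) p"

section \<open>Curves\<close>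

definition smooth_curve_on :: "real set \<Rightarrow> (real \<Rightarrow> real^3) \<Rightarrow> bool" where
  "smooth_curve_on I \<gamma> \<longleftrightarrow>
     (\<forall>n. \<forall>t\<in>I. ((\<lambda>f s. vector_derivative f (at s)) ^^ n) \<gamma> differentiable (at t))"

definition velocity :: "(real \<Rightarrow> real^3) \<Rightarrow> real \<Rightarrow> real^3" where
  "velocity \<gamma> t = vector_derivative \<gamma> (at t)"

text \<open>\<open>cov_deriv \<gamma> V\<close> is \<open>\<nabla>\<^sub>T V\<close> for a vector field \<open>V\<close> along \<open>\<gamma>\<close>, i.e. \<open>V t\<close> is a tangent
  vector at \<open>\<gamma> t\<close>.\<close>

definition cov_deriv :: "(real \<Rightarrow> real^3) \<Rightarrow> (real \<Rightarrow> real^3) \<Rightarrow> real \<Rightarrow> real^3" where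
  "cov_deriv \<gamma> V t = vector_derivative V (at t) + heis_gamma (\<gamma> t) (velocity \<gamma> t) (V t)"

definition nonnull_arclength_on :: "real set \<Rightarrow> (real \<Rightarrow> real^3) \<Rightarrow> bool" where
  "nonnull_arclength_on I \<gamma> \<longleftrightarrow>
     (\<exists>\<epsilon>1\<in>{1, -1}. \<forall>t\<in>I. heis_metric (\<gamma> t) (velocity \<gamma> t) (velocity \<gamma> t) = \<epsilon>1)"

definition acceleration :: "(real \<Rightarrow> real^3) \<Rightarrow> real \<Rightarrow> real^3" where
  "acceleration \<gamma> = cov_deriv \<gamma> (velocity \<gamma>)"

definition biharmonic_on :: "real set \<Rightarrow> (real \<Rightarrow> real^3) \<Rightarrow> bool" where
  "biharmonic_on I \<gamma> \<longleftrightarrow>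
     (\<forall>t\<in>I. cov_deriv \<gamma> (cov_deriv \<gamma> (cov_deriv \<gamma> (velocity \<gamma>))) t
       - heis_curvature (\<gamma> t) (velocity \<gamma> t) (acceleration \<gamma> t) (velocity \<gamma> t) = 0)"

section \<open>Frenet frame, curvature and torsion\<close>

definition frenet_k1 :: "(real \<Rightarrow> real^3) \<Rightarrow> real \<Rightarrow> real" where
  "frenet_k1 \<gamma> t = sqrt \<bar>heis_metric (\<gamma> t) (acceleration \<gamma> t) (acceleration \<gamma> t)\<bar>"

text \<open>The descriptions below are proper as soon as \<open>\<nabla>\<^sub>T T\<close> is not null (and, for the torsion,
  \<open>\<gamma>\<close> is a smooth unit speed curve); they carry no meaning otherwise.\<close>

definition frenet_N :: "(real \<Rightarrow> real^3) \<Rightarrow> real \<Rightarrow> real^3" where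
  "frenet_N \<gamma> t =
     (THE v. heis_metric (\<gamma> t) v v \<in> {1, -1} \<and>
        acceleration \<gamma> t = (frenet_k1 \<gamma> t * heis_metric (\<gamma> t) v v) *\<^sub>R v)"

definition frenet_B :: "(real \<Rightarrow> real^3) \<Rightarrow> real \<Rightarrow> real^3" where
  "frenet_B \<gamma> t = heis_wedge (\<gamma> t) (velocity \<gamma> t) (frenet_N \<gamma> t)"

definition frenet_eps1 :: "(real \<Rightarrow> real^3) \<Rightarrow> real \<Rightarrow> real" where
  "frenet_eps1 \<gamma> t = heis_metric (\<gamma> t) (velocity \<gamma> t) (velocity \<gamma> t)"

definition frenet_eps2 :: "(real \<Rightarrow> real^3) \<Rightarrow> real \<Rightarrow> real" where
  "frenet_eps2 \<gamma> t = heis_metric (\<gamma> t) (frenet_N \<gamma> t) (frenet_N \<gamma> t)"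

definition frenet_eps3 :: "(real \<Rightarrow> real^3) \<Rightarrow> real \<Rightarrow> real" where
  "frenet_eps3 \<gamma> t = heis_metric (\<gamma> t) (frenet_B \<gamma> t) (frenet_B \<gamma> t)"

definition frenet_k2 :: "(real \<Rightarrow> real^3) \<Rightarrow> real \<Rightarrow> real" where
  "frenet_k2 \<gamma> t =
     (THE \<kappa>.
        cov_deriv \<gamma> (frenet_N \<gamma>) t =
          - (frenet_k1 \<gamma> t * frenet_eps1 \<gamma> t) *\<^sub>R velocity \<gamma> t
          + (\<kappa> * frenet_eps3 \<gamma> t) *\<^sub>R frenet_B \<gamma> t \<and>
        cov_deriv \<gamma> (frenet_B \<gamma>) t = - (\<kappa> * frenet_eps2 \<gamma> t) *\<^sub>R frenet_N \<gamma> t)"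

end

theory Submission
  imports Defs
begin

text \<open>
  In the orthonormal frame the covariant derivative along \<open>\<gamma>\<close> is \<open>V' + \<Gamma>(T, V)\<close> with \<open>\<Gamma>\<close>
  bilinear with constant coefficients.  Put \<open>A = \<nabla>\<^sub>T T\<close>, \<open>J = \<nabla>\<^sub>T A\<close>, \<open>C = T \<and> A\<close> (a multiple of \<open>B\<close>)
  and \<open>q = g(A, A)\<close>.  Differentiating \<open>C\<^sub>3 = 0\<close> gives \<open>(g(J, C) - \<epsilon>\<^sub>1 q) A\<^sub>3 = 0\<close>.  Where \<open>A\<^sub>3\<close>
  vanishes its derivative does not, so \<open>g(J, C) = \<epsilon>\<^sub>1 q\<close> everywhere, which says \<open>k\<^sub>2 = \<epsilon>\<^sub>3\<close>.

  As \<open>B \<bottom> e\<^sub>3\<close>, the plane of \<open>T\<close> and \<open>A\<close> contains \<open>e\<^sub>3\<close>, hence \<open>g(R(T, A) T, A) = - g(C, C)\<close>.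
  For a biharmonic curve, \<open>g(\<nabla>\<^sub>T J, T) = 0\<close> forces \<open>g(A, J) = 0\<close>, and differentiating this gives
  \<open>g(J, J) = g(C, C) = \<epsilon>\<^sub>1 q\<close>, whereas \<open>J = - \<epsilon>\<^sub>1 q T + C\<close> has \<open>g(J, J) = \<epsilon>\<^sub>1 q\<^sup>2 + \<epsilon>\<^sub>1 q\<close>.
\<close>

section \<open>Frame components\<close>

definition heis_vec :: "real^3 \<Rightarrow> real^3 \<Rightarrow> real^3" where
  "heis_vec p c = vector [c $ 1, c $ 2, 2 * c $ 3 - 2 * p $ 2 * c $ 1 + 2 * p $ 1 * c $ 2]"

definition lor :: "real^3 \<Rightarrow> real^3 \<Rightarrow> real" where
  "lor a b = a $ 1 * b $ 1 - a $ 2 * b $ 2 - a $ 3 * b $ 3"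

definition lor_cross :: "real^3 \<Rightarrow> real^3 \<Rightarrow> real^3" where
  "lor_cross a b = vector [- (a $ 2 * b $ 3 - a $ 3 * b $ 2),
     - (a $ 1 * b $ 3 - a $ 3 * b $ 1), a $ 1 * b $ 2 - a $ 2 * b $ 1]"

text \<open>The connection coefficients in the orthonormal frame: \<open>\<nabla>\<^sub>T V\<close>
  has components \<open>V' + frame_gamma T V\<close>. The frame is left-invariant, so they do not
  depend on the point.\<close>

definition frame_gamma :: "real^3 \<Rightarrow> real^3 \<Rightarrow> real^3" where
  "frame_gamma a v = vector [- (a $ 2 * v $ 3 + a $ 3 * v $ 2),
     - (a $ 1 * v $ 3 + a $ 3 * v $ 1), a $ 1 * v $ 2 - a $ 2 * v $ 1]"

lemma vec3_eq_iff: "(a :: 'a^3) = b \<longleftrightarrow> a $ 1 = b $ 1 \<and> a $ 2 = b $ 2 \<and> a $ 3 = b $ 3"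
  by (simp add: vec_eq_iff forall_3)

lemma heis_vec_comp [simp]: "heis_vec p (heis_comp p v) = v"
  by (simp add: vec3_eq_iff heis_vec_def heis_comp_def field_simps)

lemma heis_comp_vec [simp]: "heis_comp p (heis_vec p c) = c"
  by (simp add: vec3_eq_iff heis_vec_def heis_comp_def field_simps)

lemma heis_comp_add: "heis_comp p (u + v) = heis_comp p u + heis_comp p v"
  by (simp add: vec3_eq_iff heis_comp_def field_simps)

lemma heis_comp_diff: "heis_comp p (u - v) = heis_comp p u - heis_comp p v"
  by (simp add: vec3_eq_iff heis_comp_def field_simps)

lemma heis_comp_scaleR: "heis_comp p (c *\<^sub>R v) = c *\<^sub>R heis_comp p v"
  by (simp add: vec3_eq_iff heis_comp_def field_simps)

lemma heis_comp_eqD: "heis_comp p u = heis_comp p v \<Longrightarrow> u = v"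
  by (metis heis_vec_comp)

lemma heis_metric_comp: "heis_metric p u v = lor (heis_comp p u) (heis_comp p v)"
  by (simp add: heis_metric_def lor_def heis_comp_def field_simps)

lemma heis_comp_wedge:
  "heis_comp p (heis_wedge p X Y) = lor_cross (heis_comp p X) (heis_comp p Y)"
  unfolding heis_wedge_def lor_cross_def Let_def
  by (simp add: vec3_eq_iff heis_comp_def heis_e1_def heis_e2_def heis_e3_def field_simps)

section \<open>Algebra of the Lorentzian form and its cross product\<close>

lemma lor_scaleR [simp]: "lor (c *\<^sub>R a) b = c * lor a b" "lor a (c *\<^sub>R b) = c * lor a b"
  by (simp_all add: lor_def algebra_simps)

lemma lor_add: "lor (a + b) c = lor a c + lor b c"
  by (simp add: lor_def algebra_simps)

lemma lor_commute: "lor a b = lor b a"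
  by (simp add: lor_def algebra_simps)

lemma lor_cross_self [simp]: "lor_cross a a = 0"
  by (simp add: vec3_eq_iff lor_cross_def)

lemma lor_cross_add: "lor_cross a (b + c) = lor_cross a b + lor_cross a c"
  by (simp add: vec3_eq_iff lor_cross_def algebra_simps)

lemma lor_cross_diff: "lor_cross a (b - c) = lor_cross a b - lor_cross a c"
  by (simp add: vec3_eq_iff lor_cross_def algebra_simps)

lemma lor_cross_scaleR: "lor_cross a (r *\<^sub>R b) = r *\<^sub>R lor_cross a b"
  by (simp add: vec3_eq_iff lor_cross_def algebra_simps)

text \<open>\<open>lor (lor_cross a b) c\<close> is minus the determinant of the three vectors, and
  diag(1, -1, -1) has determinant 1; hence this and Lagrange's identity below carry the Euclidean
  signs.\<close>

lemma lor_cross_cross: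
  "lor_cross a (lor_cross a b) = lor a b *\<^sub>R a - lor a a *\<^sub>R b"
  by (simp add: vec3_eq_iff lor_cross_def lor_def algebra_simps)

lemma lor_lor_cross:
  "lor (lor_cross a b) (lor_cross a b) = lor a a * lor b b - (lor a b)\<^sup>2"
  by (simp add: lor_cross_def lor_def algebra_simps power2_eq_square)

text \<open>Expansion of \<open>c\<close> along \<open>a\<close>, \<open>b\<close> and
  \<open>lor_cross a b\<close>, with the Gram determinant of \<open>a\<close> and \<open>b\<close>
  cleared to make it a polynomial identity.\<close>

lemma lor_gram_expansion:
  "(lor a a * lor b b - (lor a b)\<^sup>2) *\<^sub>R c =
     (lor b b * lor a c - lor a b * lor b c) *\<^sub>R a
     + (lor a a * lor b c - lor a b * lor a c) *\<^sub>R b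
     + lor (lor_cross a b) c *\<^sub>R lor_cross a b"
  by (simp add: vec3_eq_iff lor_cross_def lor_def algebra_simps power2_eq_square)

text \<open>\<open>frame_gamma a\<close> is skew for \<open>lor\<close>, and skew maps act as
  derivations of the cross product.\<close>

lemma frame_gamma_cross:
  "frame_gamma a (lor_cross v w) = lor_cross (frame_gamma a v) w + lor_cross v (frame_gamma a w)"
  by (simp add: vec3_eq_iff lor_cross_def frame_gamma_def algebra_simps)

section \<open>Connection and curvature\<close>

lemma heis_metric_has_derivative:
  "((\<lambda>q. heis_metric q u v) has_derivative
     (\<lambda>h. - ((h $ 2 * u $ 1 - h $ 1 * u $ 2) * (v $ 3 + 2 * p $ 2 * v $ 1 - 2 * p $ 1 * v $ 2)
          + (u $ 3 + 2 * p $ 2 * u $ 1 - 2 * p $ 1 * u $ 2) * (h $ 2 * v $ 1 - h $ 1 * v $ 2)) / 2))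
   (at p)"
  unfolding heis_metric_def
  by (rule derivative_eq_intros bounded_linear.has_derivative[OF bounded_linear_vec_nth] refl)+
     (simp add: fun_eq_iff field_simps)

lemma heis_metric_partial_eq:
  "heis_metric_partial i j l p = (let h = axis i 1; u = axis j 1; v = axis l 1 in
      - ((h $ 2 * u $ 1 - h $ 1 * u $ 2) * (v $ 3 + 2 * p $ 2 * v $ 1 - 2 * p $ 1 * v $ 2)
          + (u $ 3 + 2 * p $ 2 * u $ 1 - 2 * p $ 1 * u $ 2) * (h $ 2 * v $ 1 - h $ 1 * v $ 2)) / 2)"
  unfolding heis_metric_partial_def heis_metric_matrix_def Let_def
  using frechet_derivative_at[OF heis_metric_has_derivative, symmetric]
  by simp

lemma matrix_inv_heis_metric_matrix:
  "matrix_inv (heis_metric_matrix p) =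
     vector [vector [1, 0, - 2 * p $ 2], vector [0, - 1, - 2 * p $ 1],
       vector [- 2 * p $ 2, - 2 * p $ 1, 4 * (p $ 2)\<^sup>2 - 4 * (p $ 1)\<^sup>2 - 4]]"
    (is "_ = ?M")
proof -
  have *: "heis_metric_matrix p ** ?M = mat 1" "?M ** heis_metric_matrix p = mat 1"
    by (simp_all add: vec_eq_iff forall_3 matrix_matrix_mult_def sum_3 mat_def
        heis_metric_matrix_def heis_metric_def axis_def field_simps power2_eq_square)
  show ?thesis
    unfolding matrix_inv_def
  proof (rule some_equality)
    \<comment> \<open>\<open>matrix_inv\<close> is a choice, so uniqueness of the two-sided inverse
      matters.\<close>
    fix N
    assume N: "heis_metric_matrix p ** N = mat 1 \<and> N ** heis_metric_matrix p = mat 1"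
    have "N = ?M ** (heis_metric_matrix p ** N)"
      by (simp only: matrix_mul_assoc *(2) matrix_mul_lid)
    then show "N = ?M"
      by (simp only: N matrix_mul_rid)
  qed (rule conjI[OF *])
qed

text \<open>Torsion-freeness makes this symmetric in \<open>u\<close> and \<open>v\<close>. The
  antisymmetric third entry of \<open>frame_gamma\<close> arises only once frame components are
  differentiated.\<close>

lemma heis_gamma_eq:
  "heis_gamma p u v = heis_vec p (vector
     [- (u $ 2 * heis_comp p v $ 3 + v $ 2 * heis_comp p u $ 3),
      - (u $ 1 * heis_comp p v $ 3 + v $ 1 * heis_comp p u $ 3), 0])"
  unfolding heis_gamma_def heis_christoffel_def
  by (simp add: vec3_eq_iff sum_3 heis_metric_partial_eq matrix_inv_heis_metric_matrix axis_def
    heis_vec_def heis_comp_def field_simps power2_eq_square)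

section \<open>Derivatives in coordinates, the curvature tensor, and differentiation of frame
  components\<close>

lemmas has_derivative_vec_nth [derivative_intros] =
  bounded_linear.has_derivative[OF bounded_linear_vec_nth]

lemma heis_comp_has_derivative_3:
  "((\<lambda>q. heis_comp q v $ 3) has_derivative (\<lambda>h. h $ 2 * v $ 1 - h $ 1 * v $ 2)) (at p)"
  unfolding heis_comp_def vector_3
  by (rule derivative_eq_intros refl | simp add: fun_eq_iff field_simps)+

lemma has_derivative_vec_iff:
  fixes f :: "'b::real_normed_vector \<Rightarrow> real^'n"
  shows "(f has_derivative f') (at x) \<longleftrightarrow>
     (\<forall>i. ((\<lambda>x. f x $ i) has_derivative (\<lambda>h. f' h $ i)) (at x))"
  unfolding has_derivative_componentwise_within[of f f' x UNIV]
  by (auto simp: Basis_vec_def inner_axis)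

lemma has_vector_derivative_vec_iff:
  fixes f :: "real \<Rightarrow> real^'n"
  shows "(f has_vector_derivative f') (at t) \<longleftrightarrow>
     (\<forall>i. ((\<lambda>s. f s $ i) has_real_derivative f' $ i) (at t))"
  unfolding has_vector_derivative_def has_derivative_vec_iff has_field_derivative_def
  by (simp add: mult_commute_abs)

text \<open>The first two entries differentiate \<open>heis_comp\<close>; the third is the effect of
  moving the base point of \<open>heis_vec\<close>.\<close>

lemma heis_gamma_has_derivative:
  "((\<lambda>q. heis_gamma q v w) has_derivative (\<lambda>h.
      heis_vec p (vector
       [- (v $ 2 * (h $ 2 * w $ 1 - h $ 1 * w $ 2) + w $ 2 * (h $ 2 * v $ 1 - h $ 1 * v $ 2)),
        - (v $ 1 * (h $ 2 * w $ 1 - h $ 1 * w $ 2) + w $ 1 * (h $ 2 * v $ 1 - h $ 1 * v $ 2)),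
        h $ 2 * (v $ 2 * heis_comp p w $ 3 + w $ 2 * heis_comp p v $ 3)
        - h $ 1 * (v $ 1 * heis_comp p w $ 3 + w $ 1 * heis_comp p v $ 3)]))) (at p)"
  unfolding has_derivative_vec_iff forall_3 heis_gamma_eq heis_vec_def vector_3
  by (intro conjI; (rule heis_comp_has_derivative_3 derivative_eq_intros refl)+;
      simp add: fun_eq_iff field_simps)

text \<open>The curvature depends on \<open>u\<close> and \<open>v\<close> only through the bivector
  \<open>\<omega>\<close>, and is diagonal in the frame planes: weight 3 on the horizontal plane, 1
  in absolute value on the two planes containing \<open>e\<^sub>3\<close>.\<close>

lemma heis_curvature_comp:
  fixes p u v w
  defines "U \<equiv> heis_comp p u" and "V \<equiv> heis_comp p v" and "W \<equiv> heis_comp p w"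
  defines "\<omega> \<equiv> (\<lambda>i j. U $ i * V $ j - U $ j * V $ i)"
  shows "heis_comp p (heis_curvature p u v w) = vector
    [3 * \<omega> 1 2 * W $ 2 - \<omega> 1 3 * W $ 3, 3 * \<omega> 1 2 * W $ 1 - \<omega> 2 3 * W $ 3,
     \<omega> 2 3 * W $ 2 - \<omega> 1 3 * W $ 1]"
proof -
  have nabla: "heis_nabla (\<lambda>_. v) (\<lambda>_. w) = (\<lambda>q. heis_gamma q v w)" for v w
    by (simp add: heis_nabla_def fun_eq_iff)
  have br: "lie_bracket (\<lambda>_. u) (\<lambda>_. v) = (\<lambda>_. 0)"
    by (simp add: lie_bracket_def fun_eq_iff)
  have zero: "heis_gamma p 0 w = 0"
    by (simp add: heis_gamma_def vec_eq_iff)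
  have comps: "heis_comp p x $ 1 = x $ 1" "heis_comp p x $ 2 = x $ 2" for x
    by (simp_all add: heis_comp_def)
  have gam: "heis_comp p (heis_gamma p x y) = vector
     [- (x $ 2 * heis_comp p y $ 3 + y $ 2 * heis_comp p x $ 3),
      - (x $ 1 * heis_comp p y $ 3 + y $ 1 * heis_comp p x $ 3), 0]" for x y
    by (simp add: heis_gamma_eq)
  have gam12: "heis_gamma p x y $ 1 = - (x $ 2 * heis_comp p y $ 3 + y $ 2 * heis_comp p x $ 3)"
    "heis_gamma p x y $ 2 = - (x $ 1 * heis_comp p y $ 3 + y $ 1 * heis_comp p x $ 3)" for x y
    by (simp_all add: heis_gamma_eq heis_vec_def)
  show ?thesis
    unfolding heis_curvature_def heis_curvature_field_def nabla br
    unfolding heis_nabla_def frechet_derivative_at[OF heis_gamma_has_derivative, symmetric]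
    by (simp add: zero heis_comp_add heis_comp_diff gam gam12 vec3_eq_iff
        U_def V_def W_def \<omega>_def comps algebra_simps)
qed

text \<open>R(u, v) is skew for the metric.\<close>

lemma lor_curvature_self:
  "lor (heis_comp p u) (heis_comp p (heis_curvature p u v u)) = 0"
  by (simp add: heis_curvature_comp lor_def algebra_simps)

text \<open>The curvature is that of constant curvature 1 plus a term seeing only the horizontal
  part of the bivector. That part is the third component of the wedge, so it disappears when
  \<open>B\<^sub>3 = 0\<close>.\<close>

lemma lor_curvature:
  "lor (heis_comp p v) (heis_comp p (heis_curvature p u v u)) =
     - lor (heis_comp p (heis_wedge p u v)) (heis_comp p (heis_wedge p u v))
     - 4 * (heis_comp p (heis_wedge p u v) $ 3)\<^sup>2"
  by (simp add: heis_curvature_comp heis_comp_wedge lor_cross_def lor_def algebra_simps power2_eq_square)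

text \<open>The bridge from coordinates to the frame: differentiating \<open>heis_comp\<close> along
  the curve supplies the term by which \<open>frame_gamma\<close> differs from the Christoffel
  term.\<close>

lemma heis_comp_has_vector_derivative:
  assumes "\<gamma> differentiable at t" "V differentiable at t"
  shows "((\<lambda>s. heis_comp (\<gamma> s) (V s)) has_vector_derivative
      heis_comp (\<gamma> t) (cov_deriv \<gamma> V t)
      - frame_gamma (heis_comp (\<gamma> t) (velocity \<gamma> t)) (heis_comp (\<gamma> t) (V t))) (at t)"
proof -
  let ?v = "velocity \<gamma> t" and ?V = "vector_derivative V (at t)"
  have *: "((\<lambda>s. \<gamma> s $ i) has_real_derivative ?v $ i) (at t)"
    "((\<lambda>s. V s $ i) has_real_derivative ?V $ i) (at t)" for i
    using assms unfolding velocity_def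
    by (simp_all add: vector_derivative_works has_vector_derivative_vec_iff)
  show ?thesis
    unfolding has_vector_derivative_vec_iff forall_3 cov_deriv_def heis_comp_def vector_3
      heis_gamma_eq heis_vec_def frame_gamma_def vector_minus_component vector_add_component
    by (intro conjI; (rule derivative_eq_intros * refl | simp add: field_simps)+)
qed

section \<open>Smooth curves\<close>

text \<open>Recursion on the order, for real and vector values alike, so that closure properties
  follow by induction.\<close>

primrec ndiff :: "nat \<Rightarrow> real set \<Rightarrow> (real \<Rightarrow> 'a::real_normed_vector) \<Rightarrow> bool" where
  "ndiff 0 I f \<longleftrightarrow> True"
| "ndiff (Suc n) I f \<longleftrightarrow>
     (\<forall>t\<in>I. f differentiable at t) \<and> ndiff n I (\<lambda>t. vector_derivative f (at t))"

definition smooth :: "real set \<Rightarrow> (real \<Rightarrow> 'a::real_normed_vector) \<Rightarrow> bool" where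
  "smooth I f \<longleftrightarrow> (\<forall>n. ndiff n I f)"

lemma vector_derivative_cong_open:
  assumes "open I" "t \<in> I" "\<And>s. s \<in> I \<Longrightarrow> f s = g s"
  shows "vector_derivative f (at t) = vector_derivative g (at t)"
  by (rule vector_derivative_cong_eq)
     (use assms eventually_nhds_in_open[OF assms(1,2)] in \<open>auto elim: eventually_mono\<close>)

text \<open>The sum and product rules for \<open>vector_derivative\<close> are available only at
  points of \<open>I\<close>; this lets them be substituted into the next derivative.\<close>

lemma ndiff_cong:
  assumes "open I" "\<And>s. s \<in> I \<Longrightarrow> f s = g s" "ndiff n I f"
  shows "ndiff n I g"
  using assms(2,3)
proof (induction n arbitrary: f g)
  case (Suc n)
  have "g differentiable at t" if "t \<in> I" for t
  proof -
    have "(f has_vector_derivative vector_derivative f (at t)) (at t)"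
      using Suc.prems that by (simp add: vector_derivative_works)
    then show ?thesis
      using has_vector_derivative_transform_within_open[OF _ assms(1) that] Suc.prems(1)
      by (metis differentiableI_vector)
  qed
  moreover have "ndiff n I (\<lambda>t. vector_derivative g (at t))"
  proof (rule Suc.IH)
    show "ndiff n I (\<lambda>t. vector_derivative f (at t))"
      using Suc.prems by simp
  qed (intro vector_derivative_cong_open[OF assms(1)] Suc.prems)
  ultimately show ?case by simp
qed simp

lemma ndiff_SucD: "ndiff (Suc n) I f \<Longrightarrow> ndiff n I f"
  by (induction n arbitrary: f) auto

lemma ndiff_const: "ndiff n I (\<lambda>_. c)"
  by (induction n arbitrary: c) auto

lemma ndiff_add:
  assumes "open I" "ndiff n I f" "ndiff n I g"
  shows "ndiff n I (\<lambda>t. f t + g t)"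
  using assms(2,3)
proof (induction n arbitrary: f g)
  case (Suc n)
  have "ndiff n I (\<lambda>t. vector_derivative f (at t) + vector_derivative g (at t))"
    using Suc by simp
  then have "ndiff n I (\<lambda>t. vector_derivative (\<lambda>t. f t + g t) (at t))"
    by (rule ndiff_cong[OF assms(1), rotated]) (use Suc.prems in simp)
  then show ?case using Suc.prems by simp
qed simp

text \<open>By the Leibniz rule the derivative is a sum of two products to which the induction
  applies. Real products, scalar multiples and coordinates (inner products with
  \<open>axis i 1\<close>) are all instances.\<close>

lemma (in bounded_bilinear) ndiff:
  assumes "open I" "ndiff n I f" "ndiff n I g"
  shows "ndiff n I (\<lambda>t. prod (f t) (g t))"
  using assms(2,3)
proof (induction n arbitrary: f g)
  case (Suc n)
  let ?f' = "\<lambda>t. vector_derivative f (at t)" and ?g' = "\<lambda>t. vector_derivative g (at t)"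
  have D: "((\<lambda>t. prod (f t) (g t)) has_vector_derivative prod (f t) (?g' t) + prod (?f' t) (g t))
      (at t)" if "t \<in> I" for t
    using Suc.prems that by (intro has_vector_derivative) (auto simp: vector_derivative_works)
  have "ndiff n I (\<lambda>t. prod (f t) (?g' t) + prod (?f' t) (g t))"
    using Suc.prems by (intro ndiff_add assms Suc.IH) (auto dest: ndiff_SucD simp del: ndiff.simps, auto)
  then have "ndiff n I (\<lambda>t. vector_derivative (\<lambda>t. prod (f t) (g t)) (at t))"
    by (rule ndiff_cong[OF assms(1), rotated]) (use D vector_derivative_at in metis)
  then show ?case using D by (auto intro: differentiableI_vector)
qed simp

lemma smooth_differentiable: "smooth I f \<Longrightarrow> t \<in> I \<Longrightarrow> f differentiable at t"
  unfolding smooth_def using ndiff.simps(2)[of 0] by blast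

lemma smooth_vector_derivative: "smooth I f \<Longrightarrow> smooth I (\<lambda>t. vector_derivative f (at t))"
  unfolding smooth_def using ndiff.simps(2) by blast

lemma smooth_const: "smooth I (\<lambda>_. c)"
  by (simp add: smooth_def ndiff_const)

lemma smooth_add: "open I \<Longrightarrow> smooth I f \<Longrightarrow> smooth I g \<Longrightarrow> smooth I (\<lambda>t. f t + g t)"
  by (simp add: smooth_def ndiff_add)

lemma smooth_mult:
  fixes f g :: "real \<Rightarrow> real"
  shows "open I \<Longrightarrow> smooth I f \<Longrightarrow> smooth I g \<Longrightarrow> smooth I (\<lambda>t. f t * g t)"
  by (simp add: smooth_def bounded_bilinear.ndiff[OF bounded_bilinear_mult])

lemma smooth_scaleR:
  "open I \<Longrightarrow> smooth I f \<Longrightarrow> smooth I g \<Longrightarrow> smooth I (\<lambda>t. f t *\<^sub>R g t)"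
  by (simp add: smooth_def bounded_bilinear.ndiff[OF bounded_bilinear_scaleR])

lemma smooth_uminus:
  fixes f :: "real \<Rightarrow> real"
  shows "open I \<Longrightarrow> smooth I f \<Longrightarrow> smooth I (\<lambda>t. - f t)"
  using smooth_mult[OF _ smooth_const, of I f "-1"] by simp

lemma smooth_diff:
  fixes f g :: "real \<Rightarrow> real"
  shows "open I \<Longrightarrow> smooth I f \<Longrightarrow> smooth I g \<Longrightarrow> smooth I (\<lambda>t. f t - g t)"
  using smooth_add[of I f "\<lambda>t. - g t"] smooth_uminus by simp

lemma smooth_divide_const:
  fixes f :: "real \<Rightarrow> real"
  shows "open I \<Longrightarrow> smooth I f \<Longrightarrow> smooth I (\<lambda>t. f t / c)"
  using smooth_mult[OF _ smooth_const, of I f "inverse c"] by (simp add: field_simps)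

lemma smooth_vec_nth:
  fixes f :: "real \<Rightarrow> real^'n"
  assumes "open I" "smooth I f"
  shows "smooth I (\<lambda>t. f t $ i)"
  using bounded_bilinear.ndiff[OF bounded_bilinear_inner assms(1) _ ndiff_const, of _ f "axis i 1"] assms(2)
  by (simp add: smooth_def inner_axis)

lemma smooth_vecI:
  fixes f :: "real \<Rightarrow> real^3"
  assumes "open I" "smooth I (\<lambda>t. f t $ 1)" "smooth I (\<lambda>t. f t $ 2)" "smooth I (\<lambda>t. f t $ 3)"
  shows "smooth I f"
proof -
  have "f = (\<lambda>t. f t $ 1 *\<^sub>R axis 1 1 + f t $ 2 *\<^sub>R axis 2 1 + f t $ 3 *\<^sub>R axis 3 1)"
    by (simp add: fun_eq_iff vec3_eq_iff axis_def)
  moreover have "smooth I \<dots>"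
    by (intro smooth_add smooth_scaleR smooth_const assms)
  ultimately show ?thesis by simp
qed

lemma smooth_vector:
  fixes a b c :: "real \<Rightarrow> real"
  assumes "open I" "smooth I a" "smooth I b" "smooth I c"
  shows "smooth I (\<lambda>t. vector [a t, b t, c t] :: real^3)"
  by (rule smooth_vecI) (simp_all add: assms)

lemmas smooth_intros = smooth_const smooth_add smooth_mult smooth_uminus smooth_diff
  smooth_divide_const smooth_vec_nth

lemma smooth_curve_on_imp_smooth:
  assumes "smooth_curve_on I f"
  shows "smooth I f"
proof -
  have "ndiff n I f" if "smooth_curve_on I f" for n f
    using that
  proof (induction n arbitrary: f)
    case (Suc n)
    let ?D = "\<lambda>f s. vector_derivative f (at s)"
    have *: "(?D ^^ m) f differentiable at t" if "t \<in> I" for m t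
      using Suc.prems that unfolding smooth_curve_on_def by blast
    have "smooth_curve_on I (?D f)"
      unfolding smooth_curve_on_def
    proof safe
      fix m t assume "t \<in> I"
      then show "(?D ^^ m) (?D f) differentiable at t"
        using *[of t "Suc m"] by (simp only: funpow_Suc_right o_apply)
    qed
    then show ?case using *[of _ 0] Suc.IH by simp
  qed simp
  then show ?thesis using assms by (simp add: smooth_def)
qed

text \<open>By \<open>heis_gamma_eq\<close> the Christoffel term is polynomial in the coordinates of
  \<gamma>, its velocity and \<open>V\<close>.\<close>

lemma smooth_cov_deriv:
  assumes "open I" "smooth I \<gamma>" "smooth I V"
  shows "smooth I (cov_deriv \<gamma> V)"
proof -
  have v: "smooth I (velocity \<gamma>)"
    using smooth_vector_derivative[OF assms(2)] by (simp add: velocity_def[abs_def])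
  have "smooth I (\<lambda>t. heis_gamma (\<gamma> t) (velocity \<gamma> t) (V t))"
    unfolding heis_gamma_eq heis_vec_def heis_comp_def vector_3
    by (intro smooth_vector smooth_intros assms v)
  then show ?thesis
    unfolding cov_deriv_def[abs_def]
    by (intro smooth_add smooth_vector_derivative assms)
qed

section \<open>Curves whose binormal is orthogonal to the fibre\<close>

text \<open>\<open>w t\<close> is the covariant derivative at \<open>t\<close> of the field \<open>v\<close> along a curve with velocity \<open>a\<close>, all
  given by frame components.\<close>

definition frame_deriv ::
  "(real \<Rightarrow> real^3) \<Rightarrow> (real \<Rightarrow> real^3) \<Rightarrow> (real \<Rightarrow> real^3) \<Rightarrow> real \<Rightarrow> bool" where
  "frame_deriv a v w t \<longleftrightarrow> (v has_vector_derivative w t - frame_gamma (a t) (v t)) (at t)"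

text \<open>Metric compatibility: the \<open>frame_gamma\<close> terms cancel by skewness.\<close>

lemma frame_deriv_lor:
  assumes "frame_deriv a v v' t" "frame_deriv a w w' t"
  shows "((\<lambda>s. lor (v s) (w s)) has_real_derivative lor (v' t) (w t) + lor (v t) (w' t)) (at t)"
proof -
  have *: "((\<lambda>s. v s $ i) has_real_derivative (v' t - frame_gamma (a t) (v t)) $ i) (at t)"
    "((\<lambda>s. w s $ i) has_real_derivative (w' t - frame_gamma (a t) (w t)) $ i) (at t)" for i
    using assms by (auto simp: frame_deriv_def has_vector_derivative_vec_iff)
  show ?thesis
    unfolding lor_def
    by (rule derivative_eq_intros * refl)+ (simp add: frame_gamma_def algebra_simps)
qed

lemma frame_deriv_cross:
  assumes "frame_deriv a v v' t" "frame_deriv a w w' t"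
  shows "frame_deriv a (\<lambda>s. lor_cross (v s) (w s))
           (\<lambda>s. lor_cross (v' s) (w s) + lor_cross (v s) (w' s)) t"
proof -
  have *: "((\<lambda>s. v s $ i) has_real_derivative (v' t - frame_gamma (a t) (v t)) $ i) (at t)"
    "((\<lambda>s. w s $ i) has_real_derivative (w' t - frame_gamma (a t) (w t)) $ i) (at t)" for i
    using assms by (auto simp: frame_deriv_def has_vector_derivative_vec_iff)
  show ?thesis
    unfolding frame_deriv_def frame_gamma_cross has_vector_derivative_vec_iff forall_3
      lor_cross_def vector_3
    by (intro conjI; (rule derivative_eq_intros * refl)+; simp add: frame_gamma_def algebra_simps)
qed

lemma has_real_derivative_const_on_open:
  fixes f :: "real \<Rightarrow> real"
  assumes "open I" "t \<in> I" "(f has_real_derivative D) (at t)" "\<And>s. s \<in> I \<Longrightarrow> f s = c"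
  shows "D = 0"
proof -
  have "((\<lambda>_. c) has_real_derivative D) (at t)"
    using assms by (intro has_field_derivative_transform_within_open[OF assms(3,1,2)]) auto
  then show ?thesis
    using DERIV_const DERIV_unique by blast
qed

text \<open>\<open>a\<close>, \<open>\<alpha>\<close>, \<open>j\<close>, \<open>k\<close> are the frame components of \<open>T\<close> and its iterated covariant derivatives.\<close>

locale frame_curve =
  fixes I :: "real set" and a \<alpha> j k :: "real \<Rightarrow> real^3" and e :: real
  assumes open_I: "open I"
    and a_deriv: "\<And>t. t \<in> I \<Longrightarrow> frame_deriv a a \<alpha> t"
    and \<alpha>_deriv: "\<And>t. t \<in> I \<Longrightarrow> frame_deriv a \<alpha> j t"
    and j_deriv: "\<And>t. t \<in> I \<Longrightarrow> frame_deriv a j k t"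
    and unit: "\<And>t. t \<in> I \<Longrightarrow> lor (a t) (a t) = e"
    and e_sq: "e * e = 1"
    and nonnull: "\<And>t. t \<in> I \<Longrightarrow> lor (\<alpha> t) (\<alpha> t) \<noteq> 0"
    and cross_3: "\<And>t. t \<in> I \<Longrightarrow> lor_cross (a t) (\<alpha> t) $ 3 = 0"
begin

section \<open>Frenet relations for the unnormalized frame T, A, C\<close>

lemma lor_a_\<alpha>: "t \<in> I \<Longrightarrow> lor (a t) (\<alpha> t) = 0"
  using has_real_derivative_const_on_open[OF open_I _ frame_deriv_lor[OF a_deriv a_deriv] unit, of t]
  by (simp add: lor_commute[of "\<alpha> t" "a t"])

lemma lor_a_j: "t \<in> I \<Longrightarrow> lor (a t) (j t) = - lor (\<alpha> t) (\<alpha> t)"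
  using has_real_derivative_const_on_open[OF open_I _ frame_deriv_lor[OF a_deriv \<alpha>_deriv] lor_a_\<alpha>, of t]
  by simp

lemma lor_cross_a_\<alpha>: "t \<in> I \<Longrightarrow>
    lor (lor_cross (a t) (\<alpha> t)) (lor_cross (a t) (\<alpha> t)) = e * lor (\<alpha> t) (\<alpha> t)"
  by (simp add: lor_lor_cross lor_a_\<alpha> unit)

lemma cross_deriv:
  "t \<in> I \<Longrightarrow> frame_deriv a (\<lambda>s. lor_cross (a s) (\<alpha> s)) (\<lambda>s. lor_cross (a s) (j s)) t"
  using frame_deriv_cross[OF a_deriv \<alpha>_deriv] by simp

text \<open>Differentiate \<open>C\<^sub>3 = 0\<close>. The third rows of \<open>frame_gamma\<close>
  and \<open>lor_cross\<close> agree, so the correction term is the third component of T \<and> C =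
  - e A.\<close>

lemma cross_j_3:
  assumes "t \<in> I"
  shows "lor_cross (a t) (j t) $ 3 = - e * \<alpha> t $ 3"
proof -
  let ?C = "lor_cross (a t) (\<alpha> t)"
  have "((\<lambda>s. lor_cross (a s) (\<alpha> s) $ 3) has_real_derivative
      lor_cross (a t) (j t) $ 3 - frame_gamma (a t) ?C $ 3) (at t)"
    using cross_deriv[OF assms] by (simp add: frame_deriv_def has_vector_derivative_vec_iff)
  then have "lor_cross (a t) (j t) $ 3 - frame_gamma (a t) ?C $ 3 = 0"
    by (rule has_real_derivative_const_on_open[OF open_I assms]) (rule cross_3)
  moreover have "frame_gamma (a t) ?C $ 3 = lor_cross (a t) ?C $ 3"
    by (simp add: frame_gamma_def lor_cross_def)
  moreover have "lor_cross (a t) ?C = - e *\<^sub>R \<alpha> t"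
    by (simp add: lor_cross_cross lor_a_\<alpha> unit assms)
  ultimately show ?thesis
    by simp
qed

lemma j_expansion:
  assumes "t \<in> I"
  shows "(e * lor (\<alpha> t) (\<alpha> t)) *\<^sub>R j t =
     - (lor (\<alpha> t) (\<alpha> t))\<^sup>2 *\<^sub>R a t + (e * lor (\<alpha> t) (j t)) *\<^sub>R \<alpha> t
     + lor (lor_cross (a t) (\<alpha> t)) (j t) *\<^sub>R lor_cross (a t) (\<alpha> t)"
  using lor_gram_expansion[of "a t" "\<alpha> t" "j t"] assms
  by (simp add: lor_a_\<alpha> unit lor_a_j power2_eq_square)

text \<open>Compare \<open>cross_j_3\<close> with the third component of T \<and> J computed from
  \<open>j_expansion\<close>: T contributes nothing, A gives a multiple of
  \<open>C\<^sub>3 = 0\<close>, and C gives a multiple of A.\<close>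

lemma torsion_mult_\<alpha>_3:
  assumes "t \<in> I"
  shows "(lor (lor_cross (a t) (\<alpha> t)) (j t) - e * lor (\<alpha> t) (\<alpha> t)) * \<alpha> t $ 3 = 0"
proof -
  let ?C = "lor_cross (a t) (\<alpha> t)" and ?q = "lor (\<alpha> t) (\<alpha> t)"
  have "lor_cross (a t) ((e * ?q) *\<^sub>R j t) $ 3 = - lor ?C (j t) * e * \<alpha> t $ 3"
    unfolding j_expansion[OF assms]
    by (simp add: lor_cross_add lor_cross_diff lor_cross_scaleR lor_cross_cross lor_a_\<alpha> unit assms
        cross_3[OF assms])
  then have "e * e * (?q * e * \<alpha> t $ 3) = e * e * lor ?C (j t) * \<alpha> t $ 3"
    by (simp add: lor_cross_scaleR cross_j_3[OF assms] algebra_simps)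
  then show ?thesis
    by (auto simp: e_sq algebra_simps)
qed

lemma torsion:
  assumes t: "t \<in> I"
  shows "lor (lor_cross (a t) (\<alpha> t)) (j t) = e * lor (\<alpha> t) (\<alpha> t)"
proof (cases "\<alpha> t $ 3 = 0")
  case False
  then show ?thesis
    using torsion_mult_\<alpha>_3[OF t] by simp
next
  case True
  let ?f = "\<lambda>s. lor (lor_cross (a s) (\<alpha> s)) (j s) - e * lor (\<alpha> s) (\<alpha> s)"
  \<comment> \<open>The value of \<open>D\<close> is irrelevant: in the product rule it is
    multiplied by \<open>\<alpha> t $ 3 = 0\<close>.\<close>
  obtain D where D: "(?f has_real_derivative D) (at t)"
    using DERIV_diff[OF frame_deriv_lor[OF cross_deriv[OF t] j_deriv[OF t]]
        DERIV_cmult[OF frame_deriv_lor[OF \<alpha>_deriv[OF t] \<alpha>_deriv[OF t]]]] by blast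
  have \<alpha>3: "((\<lambda>s. \<alpha> s $ 3) has_real_derivative (j t - frame_gamma (a t) (\<alpha> t)) $ 3) (at t)"
    using \<alpha>_deriv[OF t] by (simp add: frame_deriv_def has_vector_derivative_vec_iff)
  have "?f t * (j t - frame_gamma (a t) (\<alpha> t)) $ 3 + D * \<alpha> t $ 3 = 0"
    using has_real_derivative_const_on_open[OF open_I t DERIV_mult[OF D \<alpha>3] torsion_mult_\<alpha>_3]
    by (simp add: algebra_simps)
  moreover have "frame_gamma (a t) (\<alpha> t) $ 3 = 0"
    using cross_3[OF t] by (simp add: frame_gamma_def lor_cross_def)
  ultimately have *: "?f t * j t $ 3 = 0"
    using True by simp
  have q: "lor (\<alpha> t) (\<alpha> t) = \<alpha> t $ 1 * \<alpha> t $ 1 - \<alpha> t $ 2 * \<alpha> t $ 2"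
    using True by (simp add: lor_def)
  have eqs: "a t $ 1 * \<alpha> t $ 1 = a t $ 2 * \<alpha> t $ 2" "a t $ 1 * \<alpha> t $ 2 = a t $ 2 * \<alpha> t $ 1"
    using lor_a_\<alpha>[OF t] cross_3[OF t] True by (simp_all add: lor_def lor_cross_def)
  \<comment> \<open>Multiply \<open>q\<close> by a horizontal component of T and substitute
    \<open>eqs\<close>; the two terms cancel.\<close>
  have "a t $ 1 * lor (\<alpha> t) (\<alpha> t) = 0" "a t $ 2 * lor (\<alpha> t) (\<alpha> t) = 0"
    unfolding q using eqs by algebra+
  then have "a t $ 1 = 0" "a t $ 2 = 0" \<comment> \<open>so \<open>T = \<plusminus>e\<^sub>3\<close> here, and \<open>\<alpha>\<^sub>3' = j\<^sub>3 \<noteq> 0\<close>\<close>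
    using nonnull[OF t] by auto
  then have "j t $ 3 \<noteq> 0"
    using lor_a_j[OF t] nonnull[OF t] by (auto simp: lor_def)
  then show ?thesis
    using * by simp
qed

text \<open>\<open>j_expansion\<close> divided by \<open>e * q\<close>, with the coefficient of C
  equal to 1 by \<open>torsion\<close>.\<close>

lemma j_eq:
  assumes "t \<in> I"
  shows "j t = - (e * lor (\<alpha> t) (\<alpha> t)) *\<^sub>R a t
     + (lor (\<alpha> t) (j t) / lor (\<alpha> t) (\<alpha> t)) *\<^sub>R \<alpha> t + lor_cross (a t) (\<alpha> t)"
proof -
  let ?q = "lor (\<alpha> t) (\<alpha> t)"
  have "e \<noteq> 0" using e_sq by auto
  have "(e * ?q) *\<^sub>R j t = (e * ?q) *\<^sub>R (- (e * ?q) *\<^sub>R a t + (lor (\<alpha> t) (j t) / ?q) *\<^sub>R \<alpha> t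
      + lor_cross (a t) (\<alpha> t))"
    unfolding j_expansion[OF assms] torsion[OF assms] using nonnull[OF assms] e_sq
    by (simp add: algebra_simps power2_eq_square)
  then show ?thesis
    using \<open>e \<noteq> 0\<close> nonnull[OF assms] by (simp only: scaleR_cancel_left) auto
qed

lemma cross_j_eq:
  assumes "t \<in> I"
  shows "lor_cross (a t) (j t) =
     (lor (\<alpha> t) (j t) / lor (\<alpha> t) (\<alpha> t)) *\<^sub>R lor_cross (a t) (\<alpha> t) - e *\<^sub>R \<alpha> t"
  by (subst j_eq[OF assms])
    (simp add: lor_cross_add lor_cross_diff lor_cross_scaleR lor_cross_cross lor_a_\<alpha> unit assms)

text \<open>The biharmonic equation enters only through the pairings of \<open>k\<close> with T and
  A, which the curvature identities provide.\<close>

lemma not_biharmonic: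
  assumes "I \<noteq> {}" and "\<And>t. t \<in> I \<Longrightarrow> lor (a t) (k t) = 0"
    and k: "\<And>t. t \<in> I \<Longrightarrow> lor (\<alpha> t) (k t) =
      - lor (lor_cross (a t) (\<alpha> t)) (lor_cross (a t) (\<alpha> t))"
  shows False
proof -
  have \<alpha>j: "lor (\<alpha> t) (j t) = 0" if t: "t \<in> I" for t
  proof -
    \<comment> \<open>This sum is identically 0 by \<open>lor_a_j\<close>; it yields g(A, J) three
      times, twice from g(A, A).\<close>
    have "((\<lambda>s. lor (a s) (j s) + lor (\<alpha> s) (\<alpha> s)) has_real_derivative
        3 * lor (\<alpha> t) (j t) + lor (a t) (k t)) (at t)"
      by (rule derivative_eq_intros frame_deriv_lor a_deriv \<alpha>_deriv j_deriv t)+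
        (simp add: lor_commute)
    then have "3 * lor (\<alpha> t) (j t) + lor (a t) (k t) = 0"
      by (rule has_real_derivative_const_on_open[OF open_I t]) (simp add: lor_a_j)
    then show ?thesis using assms(2)[OF t] by simp
  qed
  obtain t where t: "t \<in> I" using assms(1) by auto
  let ?q = "lor (\<alpha> t) (\<alpha> t)" and ?C = "lor_cross (a t) (\<alpha> t)"
  have "lor (j t) (j t) + lor (\<alpha> t) (k t) = 0"
    using has_real_derivative_const_on_open[OF open_I t frame_deriv_lor[OF \<alpha>_deriv j_deriv] \<alpha>j] t
    by simp
  then have "lor (j t) (j t) = e * ?q"
    by (simp add: k[OF t] lor_cross_a_\<alpha>[OF t])
  moreover have "j t = - (e * ?q) *\<^sub>R a t + ?C"
    using j_eq[OF t] \<alpha>j[OF t] by simp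
  \<comment> \<open>Pair the formula for \<open>j t\<close> with \<open>j t\<close>, using g(T, J) =
    - q and g(C, J) = e q.\<close>
  then have "lor (j t) (j t) = e * ?q\<^sup>2 + e * ?q"
    using lor_a_j[OF t] torsion[OF t]
    by (metis (no_types, lifting) lor_add lor_scaleR(1) mult_minus_left mult_minus_right
        minus_minus mult.assoc power2_eq_square)
  ultimately show False
    using nonnull[OF t] e_sq by auto
qed

end

section \<open>Frenet frame\<close>

lemma heis_metric_scaleR: "heis_metric p (c *\<^sub>R u) (d *\<^sub>R v) = c * d * heis_metric p u v"
  by (simp add: heis_metric_comp heis_comp_scaleR)

lemma heis_wedge_scaleR: "heis_wedge p u (c *\<^sub>R v) = c *\<^sub>R heis_wedge p u v"
  by (rule heis_comp_eqD[of p]) (simp add: heis_comp_wedge heis_comp_scaleR lor_cross_scaleR)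

lemma heis_gamma_scaleR: "heis_gamma p u (c *\<^sub>R v) = c *\<^sub>R heis_gamma p u v"
  by (simp add: heis_gamma_def vec_eq_iff sum_distrib_left algebra_simps)

lemma smooth_heis_wedge:
  assumes "open I" "smooth I \<gamma>" "smooth I V" "smooth I W"
  shows "smooth I (\<lambda>t. heis_wedge (\<gamma> t) (V t) (W t))"
proof -
  have eq: "heis_wedge p u v = heis_vec p (lor_cross (heis_comp p u) (heis_comp p v))" for p u v
    by (metis heis_comp_wedge heis_vec_comp)
  show ?thesis
    unfolding eq heis_vec_def lor_cross_def heis_comp_def vector_3
    by (intro smooth_vector smooth_intros assms)
qed

text \<open>Needed because the descriptions of N and B are identified with multiples of A and C only
  on \<open>I\<close>.\<close>

lemma cov_deriv_cong_open:
  assumes "open I" "t \<in> I" "\<And>s. s \<in> I \<Longrightarrow> V s = W s"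
  shows "cov_deriv \<gamma> V t = cov_deriv \<gamma> W t"
  using vector_derivative_cong_open[OF assms] assms(2,3) by (simp add: cov_deriv_def)

lemma cov_deriv_scaleR:
  assumes "(f has_real_derivative f') (at t)" "V differentiable at t"
  shows "cov_deriv \<gamma> (\<lambda>s. f s *\<^sub>R V s) t = f' *\<^sub>R V t + f t *\<^sub>R cov_deriv \<gamma> V t"
proof -
  have "((\<lambda>s. f s *\<^sub>R V s) has_vector_derivative
      f t *\<^sub>R vector_derivative V (at t) + f' *\<^sub>R V t) (at t)"
    using assms by (intro has_vector_derivative_scaleR) (simp_all add: vector_derivative_works)
  then show ?thesis
    by (simp add: cov_deriv_def heis_gamma_scaleR vector_derivative_at algebra_simps)
qed

lemma frame_deriv_heis_comp:
  assumes "\<gamma> differentiable at t" "V differentiable at t"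
  shows "frame_deriv (\<lambda>s. heis_comp (\<gamma> s) (velocity \<gamma> s)) (\<lambda>s. heis_comp (\<gamma> s) (V s))
    (\<lambda>s. heis_comp (\<gamma> s) (cov_deriv \<gamma> V s)) t"
  using heis_comp_has_vector_derivative[OF assms] by (simp add: frame_deriv_def)

text \<open>The wedge product is parallel: in the frame, both sides come from the derivative of the
  same component function, which is unique.\<close>

lemma cov_deriv_heis_wedge:
  assumes "open I" "t \<in> I" "smooth I \<gamma>" "smooth I V" "smooth I W"
  shows "cov_deriv \<gamma> (\<lambda>s. heis_wedge (\<gamma> s) (V s) (W s)) t =
    heis_wedge (\<gamma> t) (cov_deriv \<gamma> V t) (W t) + heis_wedge (\<gamma> t) (V t) (cov_deriv \<gamma> W t)"
proof -
  note d = smooth_differentiable[OF _ assms(2)]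
  have "frame_deriv (\<lambda>s. heis_comp (\<gamma> s) (velocity \<gamma> s))
      (\<lambda>s. heis_comp (\<gamma> s) (heis_wedge (\<gamma> s) (V s) (W s)))
      (\<lambda>s. heis_comp (\<gamma> s) (cov_deriv \<gamma> (\<lambda>s. heis_wedge (\<gamma> s) (V s) (W s)) s)) t"
    by (intro frame_deriv_heis_comp d smooth_heis_wedge assms)
  moreover have "frame_deriv (\<lambda>s. heis_comp (\<gamma> s) (velocity \<gamma> s))
      (\<lambda>s. heis_comp (\<gamma> s) (heis_wedge (\<gamma> s) (V s) (W s)))
      (\<lambda>s. heis_comp (\<gamma> s) (heis_wedge (\<gamma> s) (cov_deriv \<gamma> V s) (W s)
        + heis_wedge (\<gamma> s) (V s) (cov_deriv \<gamma> W s))) t"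
    unfolding heis_comp_wedge heis_comp_add
    by (intro frame_deriv_cross frame_deriv_heis_comp d assms)
  ultimately have "heis_comp (\<gamma> t) (cov_deriv \<gamma> (\<lambda>s. heis_wedge (\<gamma> s) (V s) (W s)) t)
     = heis_comp (\<gamma> t) (heis_wedge (\<gamma> t) (cov_deriv \<gamma> V t) (W t)
        + heis_wedge (\<gamma> t) (V t) (cov_deriv \<gamma> W t))"
    unfolding frame_deriv_def using vector_derivative_unique_at by fastforce
  then show ?thesis by (rule heis_comp_eqD)
qed

lemma frenet_N_eq:
  fixes \<gamma> t
  defines "q \<equiv> heis_metric (\<gamma> t) (acceleration \<gamma> t) (acceleration \<gamma> t)"
  assumes "q \<noteq> 0"
  shows "frenet_N \<gamma> t = (sgn q / sqrt \<bar>q\<bar>) *\<^sub>R acceleration \<gamma> t"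
proof -
  let ?A = "acceleration \<gamma> t" and ?k = "frenet_k1 \<gamma> t"
  have k: "?k = sqrt \<bar>q\<bar>" "?k > 0" "?k * ?k = \<bar>q\<bar>"
    using assms by (simp_all add: frenet_k1_def)
  let ?N = "(sgn q / ?k) *\<^sub>R ?A"
  have "frenet_N \<gamma> t = ?N"
    unfolding frenet_N_def
  proof (rule the_equality)
    have "heis_metric (\<gamma> t) ?N ?N = sgn q"
      using k assms(2)
      by (simp add: heis_metric_scaleR q_def[symmetric] sgn_if)
    then show "heis_metric (\<gamma> t) ?N ?N \<in> {1, -1} \<and>
        ?A = (?k * heis_metric (\<gamma> t) ?N ?N) *\<^sub>R ?N"
      using k(2) assms(2) by (auto simp: sgn_if)
  next
    fix v
    assume v: "heis_metric (\<gamma> t) v v \<in> {1, -1} \<and> ?A = (?k * heis_metric (\<gamma> t) v v) *\<^sub>R v"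
    define \<sigma> where "\<sigma> = heis_metric (\<gamma> t) v v"
    have A: "?A = (?k * \<sigma>) *\<^sub>R v" and \<sigma>: "\<sigma> = 1 \<or> \<sigma> = -1"
      using v by (auto simp: \<sigma>_def)
    \<comment> \<open>Taking norms in the defining equation forces the sign \<sigma>, and with it
      \<open>v\<close>.\<close>
    have "q = (?k * \<sigma>) * (?k * \<sigma>) * \<sigma>"
      unfolding q_def A heis_metric_scaleR by (simp add: \<sigma>_def)
    also have "\<dots> = \<bar>q\<bar> * \<sigma>"
      using \<sigma> k(3) by auto
    finally have "\<sigma> = sgn q"
      using assms(2) \<sigma> by (auto simp: sgn_if)
    then show "v = ?N"
      unfolding A using k(2) \<sigma> by auto
  qed
  then show ?thesis by (simp add: k(1))
qed

text \<open>The sign of \<open>q\<close> is locally constant by continuity. Written as a logarithmic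
  derivative, the result is the same for both signs.\<close>

lemma has_real_derivative_sgn_div_sqrt_abs:
  assumes "(q has_real_derivative q') (at t)" "q t \<noteq> (0::real)"
  shows "((\<lambda>s. sgn (q s) / sqrt \<bar>q s\<bar>) has_real_derivative
    - (sgn (q t) / sqrt \<bar>q t\<bar>) * q' / (2 * q t)) (at t)"
proof (cases "q t > 0")
  case True
  have "\<forall>\<^sub>F s in at t. q s > 0"
    using DERIV_isCont[OF assms(1)] True order_tendstoD(1) unfolding isCont_def by blast
  then have ev: "\<forall>\<^sub>F s in nhds t. 1 / sqrt (q s) = sgn (q s) / sqrt \<bar>q s\<bar>"
    using True by (auto simp: eventually_at_filter elim: eventually_mono)
  have "((\<lambda>s. 1 / sqrt (q s)) has_real_derivative - (1 / sqrt (q t)) * q' / (2 * q t)) (at t)"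
    using True
    by (auto intro!: derivative_eq_intros assms(1) simp: field_simps)
  then show ?thesis
    using True by (simp add: DERIV_cong_ev[OF refl ev refl, symmetric])
next
  case False
  then have neg: "q t < 0" using assms(2) by simp
  have "\<forall>\<^sub>F s in at t. q s < 0"
    using DERIV_isCont[OF assms(1)] neg order_tendstoD(2) unfolding isCont_def by blast
  then have ev: "\<forall>\<^sub>F s in nhds t. - 1 / sqrt (- q s) = sgn (q s) / sqrt \<bar>q s\<bar>"
    using neg by (auto simp: eventually_at_filter elim: eventually_mono)
  have "((\<lambda>s. - 1 / sqrt (- q s)) has_real_derivative (1 / sqrt (- q t)) * q' / (2 * q t)) (at t)"
    using neg
    by (auto intro!: derivative_eq_intros assms(1) simp: field_simps)
  then show ?thesis
    using neg by (simp add: DERIV_cong_ev[OF refl ev refl, symmetric])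
qed

section \<open>Return from frame components to the Frenet data\<close>

theorem proposition4p2:
  fixes I :: "real set" and \<gamma> :: "real \<Rightarrow> real^3"
  assumes "open I" and "is_interval I" and "I \<noteq> {}"
    and "smooth_curve_on I \<gamma>"
    and "nonnull_arclength_on I \<gamma>"
    and "\<And>t. t \<in> I \<Longrightarrow> acceleration \<gamma> t \<noteq> 0"
    and "\<And>t. t \<in> I \<Longrightarrow> heis_metric (\<gamma> t) (acceleration \<gamma> t) (acceleration \<gamma> t) \<noteq> 0"
    and "\<And>t. t \<in> I \<Longrightarrow> heis_comp (\<gamma> t) (frenet_B \<gamma> t) $ 3 = 0"
  shows "(\<forall>t\<in>I. (frenet_k2 \<gamma> t)\<^sup>2 = 1) \<and> \<not> biharmonic_on I \<gamma>"
proof -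
  note I = assms(1)
  obtain e where e: "e = 1 \<or> e = -1"
    and T_unit: "\<And>t. t \<in> I \<Longrightarrow> heis_metric (\<gamma> t) (velocity \<gamma> t) (velocity \<gamma> t) = e"
    using assms(5) unfolding nonnull_arclength_on_def by auto
  let ?T = "velocity \<gamma>" and ?A = "acceleration \<gamma>"
  let ?J = "cov_deriv \<gamma> ?A" and ?C = "\<lambda>s. heis_wedge (\<gamma> s) (?T s) (?A s)"
  define q where "q s = heis_metric (\<gamma> s) (?A s) (?A s)" for s
  \<comment> \<open>The normalizing factor: N = f A and B = f C.\<close>
  define f where "f s = sgn (q s) / sqrt \<bar>q s\<bar>" for s
  have smooth: "smooth I \<gamma>" "smooth I ?T" "smooth I ?A" "smooth I ?J"
  proof -
    show \<gamma>: "smooth I \<gamma>" using smooth_curve_on_imp_smooth assms(4) .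
    show T: "smooth I ?T"
      using smooth_vector_derivative[OF \<gamma>] by (simp add: velocity_def[abs_def])
    show A: "smooth I ?A" unfolding acceleration_def by (rule smooth_cov_deriv[OF I \<gamma> T])
    show "smooth I ?J" by (rule smooth_cov_deriv[OF I \<gamma> A])
  qed
  note diff = smooth_differentiable[OF smooth(1)] smooth_differentiable[OF smooth(2)]
    smooth_differentiable[OF smooth(3)] smooth_differentiable[OF smooth(4)]
  have q: "q t \<noteq> 0" if "t \<in> I" for t
    using assms(7)[OF that] by (simp add: q_def)
  have f: "f t \<noteq> 0" if "t \<in> I" for t
    using q[OF that] by (simp add: f_def sgn_if)
  have N: "frenet_N \<gamma> t = f t *\<^sub>R ?A t" if "t \<in> I" for t
    using frenet_N_eq[OF assms(7)[OF that]] by (simp add: f_def q_def)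
  have B: "frenet_B \<gamma> t = f t *\<^sub>R ?C t" if "t \<in> I" for t
    by (simp add: frenet_B_def N[OF that] heis_wedge_scaleR)
  let ?c = "\<lambda>V s. heis_comp (\<gamma> s) (V s)"
  interpret frame_curve I "?c ?T" "?c ?A" "?c ?J" "?c (cov_deriv \<gamma> ?J)" e
  proof
    fix t assume t: "t \<in> I"
    show "frame_deriv (?c ?T) (?c ?T) (?c ?A) t"
      using frame_deriv_heis_comp[OF diff(1,2)[OF t]] by (simp add: acceleration_def)
    show "frame_deriv (?c ?T) (?c ?A) (?c ?J) t" "frame_deriv (?c ?T) (?c ?J) (?c (cov_deriv \<gamma> ?J)) t"
      by (intro frame_deriv_heis_comp diff t)+
    show "lor (?c ?T t) (?c ?T t) = e" "lor (?c ?A t) (?c ?A t) \<noteq> 0"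
      using T_unit[OF t] q[OF t] by (simp_all add: heis_metric_comp q_def)
    show "lor_cross (?c ?T t) (?c ?A t) $ 3 = 0"
      using assms(8)[OF t] f[OF t] by (simp add: B[OF t] heis_comp_scaleR heis_comp_wedge)
  qed (use I e in auto)
  have "(frenet_k2 \<gamma> t)\<^sup>2 = 1" if t: "t \<in> I" for t
  proof -
    \<comment> \<open>The coefficient of A in J, which is also half the logarithmic derivative of
      \<open>q\<close>.\<close>
    define x where "x = lor (?c ?A t) (?c ?J t) / q t"
    have q': "q t = lor (?c ?A t) (?c ?A t)"
      by (simp add: q_def heis_metric_comp)
    have J: "?J t = - (e * q t) *\<^sub>R ?T t + x *\<^sub>R ?A t + ?C t"
      by (rule heis_comp_eqD[of "\<gamma> t"])
        (use j_eq[OF t] in \<open>simp only: q' x_def heis_comp_add heis_comp_scaleR heis_comp_wedge\<close>)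
    have TJ: "heis_wedge (\<gamma> t) (?T t) (?J t) = x *\<^sub>R ?C t - e *\<^sub>R ?A t"
      by (rule heis_comp_eqD[of "\<gamma> t"])
        (use cross_j_eq[OF t] in \<open>simp only: q' x_def heis_comp_diff heis_comp_scaleR heis_comp_wedge\<close>)
    have AA: "heis_wedge (\<gamma> t) (?A t) (?A t) = 0"
      by (rule heis_comp_eqD[of "\<gamma> t"]) (simp add: heis_comp_wedge, simp add: heis_comp_def vec3_eq_iff)
    have "(q has_real_derivative lor (?c ?J t) (?c ?A t) + lor (?c ?A t) (?c ?J t)) (at t)"
      using frame_deriv_lor[OF \<alpha>_deriv \<alpha>_deriv] t by (simp add: q_def[abs_def] heis_metric_comp)
    then have "(q has_real_derivative 2 * x * q t) (at t)"
      using q[OF t] by (simp add: x_def lor_commute)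
    then have f': "(f has_real_derivative - (f t * x)) (at t)"
      using has_real_derivative_sgn_div_sqrt_abs[of q _ t] q[OF t] by (force simp: f_def[abs_def])
    \<comment> \<open>Since f' = - f x, the A-terms cancel here, and the C-terms cancel in
      \<open>dB\<close>.\<close>
    have dN: "cov_deriv \<gamma> (frenet_N \<gamma>) t = f t *\<^sub>R (- (e * q t) *\<^sub>R ?T t + ?C t)"
    proof -
      have "cov_deriv \<gamma> (frenet_N \<gamma>) t = cov_deriv \<gamma> (\<lambda>s. f s *\<^sub>R ?A s) t"
        by (rule cov_deriv_cong_open[OF I t N])
      also have "\<dots> = - (f t * x) *\<^sub>R ?A t + f t *\<^sub>R ?J t"
        by (rule cov_deriv_scaleR[OF f' diff(3)[OF t]])
      finally show ?thesis
        by (simp add: J algebra_simps)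
    qed
    have dB: "cov_deriv \<gamma> (frenet_B \<gamma>) t = - (e * f t) *\<^sub>R ?A t"
    proof -
      have "cov_deriv \<gamma> (frenet_B \<gamma>) t = cov_deriv \<gamma> (\<lambda>s. f s *\<^sub>R ?C s) t"
        by (rule cov_deriv_cong_open[OF I t B])
      also have "\<dots> = - (f t * x) *\<^sub>R ?C t + f t *\<^sub>R cov_deriv \<gamma> ?C t"
        by (rule cov_deriv_scaleR[OF f' smooth_differentiable[OF smooth_heis_wedge[OF I smooth(1-3)] t]])
      also have "cov_deriv \<gamma> ?C t = x *\<^sub>R ?C t - e *\<^sub>R ?A t"
        using cov_deriv_heis_wedge[OF I t smooth(1-3)]
        by (simp add: acceleration_def[symmetric] AA TJ)
      finally show ?thesis
        by (simp add: algebra_simps)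
    qed
    have fq: "f t * f t * q t = sgn (q t)" "f t * q t = sqrt \<bar>q t\<bar>"
      using q[OF t] by (simp_all add: f_def sgn_if real_div_sqrt field_simps)
    have k1: "frenet_k1 \<gamma> t = f t * q t"
      unfolding fq by (simp add: frenet_k1_def q_def)
    have e1: "frenet_eps1 \<gamma> t = e"
      by (simp add: frenet_eps1_def T_unit t)
    have e2: "frenet_eps2 \<gamma> t = sgn (q t)"
      by (simp add: frenet_eps2_def N t heis_metric_scaleR q_def[symmetric] fq)
    have e3: "frenet_eps3 \<gamma> t = e * sgn (q t)"
    proof -
      have "frenet_eps3 \<gamma> t = f t * f t * heis_metric (\<gamma> t) (?C t) (?C t)"
        by (simp add: frenet_eps3_def B t heis_metric_scaleR)
      also have "heis_metric (\<gamma> t) (?C t) (?C t) = e * q t"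
        using lor_cross_a_\<alpha>[OF t] by (simp add: heis_metric_comp heis_comp_wedge q')
      finally show ?thesis
        by (simp add: fq(1)[symmetric])
    qed
    have s: "sgn (q t) * sgn (q t) = 1" "e * e = 1"
      using q[OF t] e by (auto simp: sgn_if)
    have "frenet_k2 \<gamma> t = e * sgn (q t)"
      unfolding frenet_k2_def dN dB k1 e1 e2 e3 N[OF t] B[OF t]
    proof (rule the_equality)
      have "e * sgn (q t) * (e * sgn (q t)) = 1" "e * sgn (q t) * sgn (q t) = e"
        using s by algebra+
      then show "f t *\<^sub>R (- (e * q t) *\<^sub>R ?T t + ?C t) =
          - (f t * q t * e) *\<^sub>R ?T t + (e * sgn (q t) * (e * sgn (q t))) *\<^sub>R (f t *\<^sub>R ?C t) \<and>
          - (e * f t) *\<^sub>R ?A t = - (e * sgn (q t) * sgn (q t)) *\<^sub>R (f t *\<^sub>R ?A t)"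
        using q[OF t] by (simp add: algebra_simps)
    next
      fix \<kappa>
      assume "f t *\<^sub>R (- (e * q t) *\<^sub>R ?T t + ?C t) =
          - (f t * q t * e) *\<^sub>R ?T t + (\<kappa> * (e * sgn (q t))) *\<^sub>R (f t *\<^sub>R ?C t) \<and>
          - (e * f t) *\<^sub>R ?A t = - (\<kappa> * sgn (q t)) *\<^sub>R (f t *\<^sub>R ?A t)"
      \<comment> \<open>The second Frenet equation determines \<kappa>, because A and
        \<open>f t\<close> are nonzero.\<close>
      then have "(- (e * f t)) *\<^sub>R ?A t = (- (\<kappa> * sgn (q t) * f t)) *\<^sub>R ?A t"
        by simp
      then have "e = \<kappa> * sgn (q t)"
        using assms(6)[OF t] f[OF t] by (simp only: scaleR_cancel_right) simp
      then show "\<kappa> = e * sgn (q t)"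
        using s(1) q[OF t] by (simp add: mult.assoc)
    qed
    then show ?thesis
      using q[OF t] e by (auto simp: sgn_if)
  qed
  moreover have "\<not> biharmonic_on I \<gamma>"
  proof
    assume bih: "biharmonic_on I \<gamma>"
    have K: "cov_deriv \<gamma> ?J t = heis_curvature (\<gamma> t) (?T t) (?A t) (?T t)" if "t \<in> I" for t
      using bih that by (simp add: biharmonic_on_def acceleration_def)
    show False
    proof (rule not_biharmonic[OF assms(3)])
      fix t assume t: "t \<in> I"
      show "lor (?c ?T t) (?c (cov_deriv \<gamma> ?J) t) = 0"
        by (simp add: K[OF t] lor_curvature_self)
      show "lor (?c ?A t) (?c (cov_deriv \<gamma> ?J) t) =
          - lor (lor_cross (?c ?T t) (?c ?A t)) (lor_cross (?c ?T t) (?c ?A t))"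
        \<comment> \<open>\<open>C\<^sub>3 = 0\<close> removes the horizontal term of
          \<open>lor_curvature\<close>.\<close>
        using cross_3[OF t] by (simp add: K[OF t] lor_curvature heis_comp_wedge)
    qed
  qed
  ultimately show ?thesis by blast
qed

end
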